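(* Let $(X,d,m)$ be an ergodic random walk on a metric space, with invariant distribution $\nu$. Suppose that for any two distinct points $x,y\in X$ one has $\kappa(x,y)\geq\kappa>0$. Let $$D_x^2:=\frac{\sigma(x)^2}{n_x\kappa}\qquad\text{and}\qquad D^2:=\mathbb{E}_\nu D_x^2.$$ Suppose that the function $x\mapsto D_x^2$ is $C$-Lipschitz. Set $$t_{\max}:=\frac{2D^2}{\max(2C,3\sigma_\infty)}.$$ Then for any $1$-Lipschitz function $f:X\to\mathbb{R}$, for any $0\leq t\leq t_{\max}$ we have $$\nu\left(\{x,\ f(x)\geq t+\mathbb{E}_\nu f\}\right)\leq\exp\left(-\frac{t^2}{6D^2}\right)$$ and for $t\geq t_{\max}$ $$\nu\left(\{x,\ f(x)\geq t+\mathbb{E}_\nu f\}\right)\leq\exp\left(-\frac{t_{\max}^2}{6D^2}-\frac{t-t_{\max}}{\max(2C,3\sigma_\infty)}\right).$$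
   Context: $(X,d)$ is a Polish metric space with its Borel $\sigma$-algebra. A random walk $m$ on $X$ is a family of probability measures $(m_x)_{x\in X}$ on $X$, depending measurably on $x$, each having finite first moment. The $L^1$ transportation distance is $\mathcal{T}_1(\nu_1,\nu_2):=\inf_{\xi}\int_{X\times X} d(x,y)\,\mathrm{d}\xi(x,y)$, over all measures $\xi$ with marginals $\nu_1,\nu_2$. For distinct points $x,y$, the Ricci curvature in the direction $(x,y)$ is $\kappa(x,y):=1-\frac{\mathcal{T}_1(m_x,m_y)}{d(x,y)}$. A probability measure $\nu$ is invariant if $\nu=\int\mathrm{d}\nu(x)\,m_x$; under the assumption $\kappa(x,y)\geq\kappa>0$ there is a unique invariant probability measure with finite first moment. The spread at $x$ is $\sigma(x):=\left(\frac12\iint d(y,z)^2\,\mathrm{d}m_x(y)\,\mathrm{d}m_x(z)\right)^{1/2}$. Also $\sigma_\infty(x):=\frac12\,\mathrm{diam}\,\mathrm{Supp}\,m_x$ and $\sigma_\infty:=\sup_x\sigma_\infty(x)$. The local dimension at $x$ is $n_x:=\frac{\sigma(x)^2}{\sup\{\mathrm{Var}_{m_x}f,\ f\ 1\text{-Lipschitz}\}}$, so that $\sigma(x)^2/n_x=\sup\{\mathrm{Var}_{m_x}f,\ f\ 1\text{-Lipschitz}\}$ (which is $0$ if $m_x$ is a Dirac mass). *)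

theory Defs
  imports "HOL-Probability.Probability"
begin

definition finite_first_moment :: "'a::metric_space measure \<Rightarrow> bool" where
  "finite_first_moment \<mu> \<longleftrightarrow> (\<exists>a. (\<integral>\<^sup>+ y. ennreal (dist a y) \<partial>\<mu>) < \<top>)"

definition random_walk :: "('a::polish_space \<Rightarrow> 'a measure) \<Rightarrow> bool" where
  "random_walk m \<longleftrightarrow> m \<in> borel \<rightarrow>\<^sub>M prob_algebra borel \<and> (\<forall>x. finite_first_moment (m x))"

definition invariant_distribution :: "('a::polish_space \<Rightarrow> 'a measure) \<Rightarrow> 'a measure \<Rightarrow> bool" where
  "invariant_distribution m \<nu> \<longleftrightarrow>
     \<nu> \<in> space (prob_algebra borel) \<and> finite_first_moment \<nu> \<and> Giry_Monad.bind \<nu> m = \<nu>"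

text \<open>Ergodicity with respect to \<open>\<nu>\<close>: every Borel set that the walk \<open>\<nu>\<close>-almost surely
  neither enters nor leaves has \<open>\<nu>\<close>-measure 0 or 1.\<close>

definition ergodic :: "('a::polish_space \<Rightarrow> 'a measure) \<Rightarrow> 'a measure \<Rightarrow> bool" where
  "ergodic m \<nu> \<longleftrightarrow> (\<forall>A\<in>sets borel.
     (AE x in \<nu>. measure (m x) A = indicator A x) \<longrightarrow> measure \<nu> A = 0 \<or> measure \<nu> A = 1)"

definition couplings :: "'a::polish_space measure \<Rightarrow> 'a measure \<Rightarrow> ('a \<times> 'a) measure set" where
  "couplings \<mu> \<nu> = {\<xi>. sets \<xi> = sets (borel \<Otimes>\<^sub>M borel) \<and>
     distr \<xi> borel fst = \<mu> \<and> distr \<xi> borel snd = \<nu>}"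

definition transport_dist :: "'a::polish_space measure \<Rightarrow> 'a measure \<Rightarrow> ennreal" where
  "transport_dist \<mu> \<nu> = (INF \<xi>\<in>couplings \<mu> \<nu>. \<integral>\<^sup>+ (x, y). ennreal (dist x y) \<partial>\<xi>)"

text \<open>Only meaningful for \<open>x \<noteq> y\<close>.\<close>

definition ricci_curvature :: "('a::polish_space \<Rightarrow> 'a measure) \<Rightarrow> 'a \<Rightarrow> 'a \<Rightarrow> ereal" where
  "ricci_curvature m x y = 1 - enn2ereal (transport_dist (m x) (m y)) / ereal (dist x y)"

definition sqrt_ennreal :: "ennreal \<Rightarrow> ennreal" where
  "sqrt_ennreal a = (if a = \<top> then \<top> else ennreal (sqrt (enn2real a)))"

definition spread :: "('a::polish_space \<Rightarrow> 'a measure) \<Rightarrow> 'a \<Rightarrow> ennreal" where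
  "spread m x =
     sqrt_ennreal ((\<integral>\<^sup>+ y. \<integral>\<^sup>+ z. ennreal ((dist y z)\<^sup>2) \<partial>m x \<partial>m x) / 2)"

definition support :: "'a::topological_space measure \<Rightarrow> 'a set" where
  "support \<mu> = {x. \<forall>U. open U \<longrightarrow> x \<in> U \<longrightarrow> emeasure \<mu> U > 0}"

text \<open>The library's \<^const>\<open>diameter\<close> is real-valued and hence unspecified on unbounded sets.\<close>

definition ennreal_diameter :: "'a::metric_space set \<Rightarrow> ennreal" where
  "ennreal_diameter S = (SUP x\<in>S. SUP y\<in>S. ennreal (dist x y))"

definition granularity_at :: "('a::polish_space \<Rightarrow> 'a measure) \<Rightarrow> 'a \<Rightarrow> ennreal" where
  "granularity_at m x = ennreal_diameter (support (m x)) / 2"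

definition granularity :: "('a::polish_space \<Rightarrow> 'a measure) \<Rightarrow> ennreal" where
  "granularity m = (SUP x. granularity_at m x)"

text \<open>Only used for \<open>\<mu>\<close>-integrable \<open>f\<close>; the value is \<open>\<top>\<close> if \<open>f\<close> is not square-integrable.\<close>

definition ennreal_variance :: "'a measure \<Rightarrow> ('a \<Rightarrow> real) \<Rightarrow> ennreal" where
  "ennreal_variance \<mu> f = (\<integral>\<^sup>+ y. ennreal ((f y - (\<integral>z. f z \<partial>\<mu>))\<^sup>2) \<partial>\<mu>)"

text \<open>In \<^typ>\<open>ennreal\<close> one has \<open>a / 0 = \<top>\<close> for \<open>a > 0\<close>, whereas \<open>0 / 0 = 0\<close> and \<open>a / \<top> = 0\<close>
  for every \<open>a\<close>. With these conventions \<open>spread\<^sup>2 / local_dimension\<close> is the supremum of the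
  variances in all cases: it is \<open>0\<close> if \<open>m x\<close> is a Dirac mass, and \<open>\<top>\<close> if \<open>m x\<close> has infinite
  second moment.\<close>

definition local_dimension :: "('a::polish_space \<Rightarrow> 'a measure) \<Rightarrow> 'a \<Rightarrow> ennreal" where
  "local_dimension m x =
     (spread m x)\<^sup>2 / (SUP f\<in>{f. 1-lipschitz_on UNIV f}. ennreal_variance (m x) f)"

definition D_sq_at :: "('a::polish_space \<Rightarrow> 'a measure) \<Rightarrow> real \<Rightarrow> 'a \<Rightarrow> ennreal" where
  "D_sq_at m \<kappa> x = (spread m x)\<^sup>2 / (local_dimension m x * ennreal \<kappa>)"

definition D_sq :: "('a::polish_space \<Rightarrow> 'a measure) \<Rightarrow> 'a measure \<Rightarrow> real \<Rightarrow> ennreal" where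
  "D_sq m \<nu> \<kappa> = (\<integral>\<^sup>+ x. D_sq_at m \<kappa> x \<partial>\<nu>)"

definition tail_scale :: "('a::polish_space \<Rightarrow> 'a measure) \<Rightarrow> real \<Rightarrow> ennreal" where
  "tail_scale m C = max (2 * ennreal C) (3 * granularity m)"

text \<open>If \<open>granularity m = \<top>\<close> then \<open>t_max = 0\<close>. If \<open>tail_scale m C = 0\<close> then all \<open>m x\<close> are
  Dirac masses, so \<open>D_sq = 0\<close> and again \<open>t_max = 0\<close>.\<close>

definition t_max :: "('a::polish_space \<Rightarrow> 'a measure) \<Rightarrow> 'a measure \<Rightarrow> real \<Rightarrow> real \<Rightarrow> ennreal" where
  "t_max m \<nu> \<kappa> C = 2 * D_sq m \<nu> \<kappa> / tail_scale m C"

text \<open>\<open>exp (- a)\<close> with \<open>exp (- \<top>) = 0\<close>.\<close>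

definition exp_minus :: "ennreal \<Rightarrow> real" where
  "exp_minus a = (if a = \<top> then 0 else exp (- enn2real a))"

end

theory Submission
  imports Defs
begin

text \<open>Let \<open>M\<close> be the averaging operator of the walk and \<open>a\<^sub>k = (1 - \<kappa>/2)\<^sup>k\<close>. Put \<open>f\<^sub>0 = f\<close> and
  \<open>f\<^sub>k\<^sub>+\<^sub>1 = M f\<^sub>k + l \<kappa> D\<^sub>x\<^sup>2 a\<^sub>k\<^sup>2\<close>. Curvature contracts Lipschitz constants by \<open>1 - \<kappa>\<close>, so if
  \<open>2 l C \<le> 1\<close> then \<open>f\<^sub>k\<close> is \<open>a\<^sub>k\<close>-Lipschitz; if moreover \<open>3 l \<sigma>\<^sub>\<infinity> \<le> 1\<close>, a second-order expansion of
  the exponential gives \<open>M (exp (l f\<^sub>k)) \<le> exp (l f\<^sub>k\<^sub>+\<^sub>1)\<close>. As \<open>k\<close> grows, \<open>f\<^sub>k\<close> flattens out, and its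
  mean stays below \<open>E f + 4/3 l D\<^sup>2\<close>; invariance of \<open>\<nu>\<close> then yields
  \<open>E (exp (l f)) \<le> exp (l E f + 4/3 l\<^sup>2 D\<^sup>2)\<close> for bounded above \<open>f\<close>. The tail bounds follow from
  Markov's inequality with \<open>l = t / (2 D\<^sup>2)\<close> and \<open>l = 1 / max (2 C) (3 \<sigma>\<^sub>\<infinity>)\<close>.\<close>

subsection \<open>Lipschitz functions on probability spaces with finite first moment\<close>

text \<open>For negative \<open>u\<close> put \<open>v = - u\<close>: the second Taylor polynomial
  of \<open>exp v\<close>, times \<open>1 - v + v\<^sup>2\<close>, is already at least 1. With no
  lower bound on \<open>u\<close>, only upward deviations have to be controlled later.\<close>

lemma exp_le_quadratic:
  fixes u :: real
  assumes "u \<le> 1"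
  shows "exp u \<le> 1 + u + u\<^sup>2"
proof (cases "0 \<le> u")
  case True
  then show ?thesis using assms by (intro exp_bound)
next
  case False
  define v where "v = - u"
  have v: "0 < v" using False by (simp add: v_def)
  have "1 \<le> 1 + v\<^sup>2 / 2 + v ^ 3 / 2 + v ^ 4 / 2" using v by simp
  also have "\<dots> = (1 - v + v\<^sup>2) * (1 + v + v\<^sup>2 / 2)"
    by (simp add: power2_eq_square power3_eq_cube power4_eq_xxxx field_simps)
  also have "\<dots> \<le> (1 - v + v\<^sup>2) * exp v"
  proof (intro mult_left_mono exp_lower_Taylor_quadratic)
    have "0 \<le> (1 - v / 2)\<^sup>2 + 3 / 4 * v\<^sup>2" by simp
    also have "\<dots> = 1 - v + v\<^sup>2" by (simp add: power2_eq_square field_simps)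
    finally show "0 \<le> 1 - v + v\<^sup>2" .
  qed (use v in simp)
  finally show ?thesis by (simp add: v_def exp_minus field_simps)
qed

lemma lipschitz_on_borel_measurable:
  fixes g :: "'a::metric_space \<Rightarrow> real"
  assumes "L-lipschitz_on UNIV g"
  shows "g \<in> borel_measurable borel"
  using lipschitz_on_continuous_on[OF assms] by (rule borel_measurable_continuous_onI)

lemma lipschitz_on_max_min:
  fixes g :: "'a::metric_space \<Rightarrow> real"
  assumes "L-lipschitz_on UNIV g"
  shows "L-lipschitz_on UNIV (\<lambda>x. max (g x) c)" "L-lipschitz_on UNIV (\<lambda>x. min (g x) c)"
proof -
  have L: "0 \<le> L" and d: "\<And>x y. \<bar>g x - g y\<bar> \<le> L * dist x y"
    using assms by (auto simp: lipschitz_on_def dist_real_def)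
  have "\<bar>max (g x) c - max (g y) c\<bar> \<le> L * dist x y"
       "\<bar>min (g x) c - min (g y) c\<bar> \<le> L * dist x y" for x y
    using d[of x y] L by (smt (verit))+
  then show "L-lipschitz_on UNIV (\<lambda>x. max (g x) c)" "L-lipschitz_on UNIV (\<lambda>x. min (g x) c)"
    using L by (auto intro!: lipschitz_onI simp: dist_real_def)
qed

section \<open>Integrability, support and exponential moments for a single measure\<close>

locale moment_prob_space = prob_space \<mu> for \<mu> :: "'a::polish_space measure" +
  assumes sets_eq_borel [measurable_cong, simp]: "sets \<mu> = sets borel"
    and finite_first_moment: "finite_first_moment \<mu>"
begin

lemma space_UNIV [simp]: "space \<mu> = UNIV"
  using sets_eq_imp_space_eq[OF sets_eq_borel] by simp

lemma prob_UNIV [simp]: "prob UNIV = 1"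
  using prob_space by simp

lemma integrable_lipschitz:
  assumes "L-lipschitz_on UNIV (g :: 'a \<Rightarrow> real)"
  shows "integrable \<mu> g"
proof -
  obtain a where a: "(\<integral>\<^sup>+ y. ennreal (dist a y) \<partial>\<mu>) < \<top>"
    using finite_first_moment by (auto simp: finite_first_moment_def)
  have [measurable]: "g \<in> borel_measurable borel"
    using assms by (rule lipschitz_on_borel_measurable)
  have "integrable \<mu> (dist a)"
    using a by (intro integrableI_bounded) auto
  then have "integrable \<mu> (\<lambda>y. \<bar>g a\<bar> + L * dist a y)" by simp
  then show ?thesis
  proof (rule Bochner_Integration.integrable_bound)
    show "AE y in \<mu>. norm (g y) \<le> norm (\<bar>g a\<bar> + L * dist a y)"
    proof (rule AE_I2)
      fix y
      have "\<bar>g a - g y\<bar> \<le> L * dist a y" 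
        using lipschitz_onD[OF assms, of a y] by (simp add: dist_real_def)
      then show "norm (g y) \<le> norm (\<bar>g a\<bar> + L * dist a y)" by simp
    qed
  qed simp
qed

text \<open>By the Lindelof property, countably many open null sets already cover the complement of
  the support.\<close>

lemma AE_mem_support: "AE y in \<mu>. y \<in> support \<mu>"
proof -
  let ?F = "{U. open U \<and> emeasure \<mu> U = 0}"
  obtain F where F: "F \<subseteq> ?F" "countable F" "\<Union>F = \<Union>?F"
    using Lindelof[of ?F] by auto
  have "\<Union>F \<in> null_sets \<mu>"
    using F(1,2) by (intro null_sets_UN'[of F "\<lambda>x. x", simplified]) (auto simp: null_sets_def)
  moreover have "y \<in> \<Union>?F" if "y \<notin> support \<mu>" for y
    using that by (auto simp: support_def zero_less_iff_neq_zero)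
  ultimately show ?thesis
    using F(3) by (intro AE_I'[of "\<Union>F"]) auto
qed

lemma AE_dist_le:
  assumes "ennreal_diameter (support \<mu>) \<le> ennreal R" "0 \<le> R"
  shows "AE y in \<mu>. AE z in \<mu>. dist y z \<le> R"
  using AE_mem_support
proof eventually_elim
  case (elim y)
  show ?case using AE_mem_support
  proof eventually_elim
    case (elim z)
    have "ennreal (dist y z) \<le> ennreal_diameter (support \<mu>)"
      using \<open>y \<in> support \<mu>\<close> elim unfolding ennreal_diameter_def
      by (intro SUP_upper2[of y] SUP_upper2[of z]) auto
    with assms show ?case
      by (metis ennreal_le_iff order_trans)
  qed
qed

text \<open>Averaging \<open>f y - f z \<le> R\<close> over \<open>z\<close> gives the one-sided
  deviation bound that \<open>exp_le_quadratic\<close> asks for.\<close>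

lemma AE_le_integral_add:
  assumes f: "1-lipschitz_on UNIV (f :: 'a \<Rightarrow> real)"
    and R: "AE y in \<mu>. AE z in \<mu>. dist y z \<le> R"
  shows "AE y in \<mu>. f y \<le> (\<integral>z. f z \<partial>\<mu>) + R"
  using R
proof eventually_elim
  case (elim y)
  have int: "integrable \<mu> f" using f by (rule integrable_lipschitz)
  have "AE z in \<mu>. f y - f z \<le> R"
    using elim
  proof eventually_elim
    case (elim z)
    then show ?case using lipschitz_onD[OF f, of y z] by (auto simp: dist_real_def)
  qed
  then have "(\<integral>z. f y - f z \<partial>\<mu>) \<le> R"
    using int by (intro integral_le_const) auto
  then show ?case using int by simp
qed

text \<open>Expand at the mean: \<open>u = l * (f y - ?m)\<close> satisfies
  \<open>u \<le> l * R \<le> 1\<close>, the linear term integrates to 0, the quadratic one to at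
  most \<open>l\<^sup>2 * V\<close>, and \<open>1 + w \<le> exp w\<close> finishes.\<close>

lemma nn_integral_exp_le:
  assumes f: "1-lipschitz_on UNIV (f :: 'a \<Rightarrow> real)"
    and R: "AE y in \<mu>. AE z in \<mu>. dist y z \<le> R"
    and var: "ennreal_variance \<mu> f \<le> ennreal V" "0 \<le> V"
    and l: "0 \<le> l" "l * R \<le> 1"
  shows "(\<integral>\<^sup>+y. ennreal (exp (l * f y)) \<partial>\<mu>) \<le> ennreal (exp (l * (\<integral>y. f y \<partial>\<mu>) + l\<^sup>2 * V))"
proof -
  let ?m = "\<integral>y. f y \<partial>\<mu>"
  have int: "integrable \<mu> f" using f by (rule integrable_lipschitz)
  have [measurable]: "f \<in> borel_measurable borel" using f by (rule lipschitz_on_borel_measurable)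
  have v: "(\<integral>\<^sup>+y. ennreal ((f y - ?m)\<^sup>2) \<partial>\<mu>) \<le> ennreal V"
    using var by (simp add: ennreal_variance_def)
  then have sq: "integrable \<mu> (\<lambda>y. (f y - ?m)\<^sup>2)"
    by (intro integrableI_bounded) (auto simp: le_less_trans)
  have V: "(\<integral>y. (f y - ?m)\<^sup>2 \<partial>\<mu>) \<le> V"
    using v var(2) by (subst (asm) nn_integral_eq_integral[OF sq]) auto
  let ?b = "\<lambda>y. 1 + l * (f y - ?m) + l\<^sup>2 * (f y - ?m)\<^sup>2"
  have ib: "integrable \<mu> ?b" using int sq by auto
  have b: "(\<integral>y. ?b y \<partial>\<mu>) = 1 + l\<^sup>2 * (\<integral>y. (f y - ?m)\<^sup>2 \<partial>\<mu>)"
    using int sq by simp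
  \<comment> \<open>Completing the square; without this sign \<open>ennreal\<close> would cut off
    negative values of the quadratic bound.\<close>
  have nonneg: "0 \<le> ?b y" for y
  proof -
    have "0 \<le> (1 + l * (f y - ?m) / 2)\<^sup>2 + 3 / 4 * (l * (f y - ?m))\<^sup>2" by simp
    also have "\<dots> = ?b y" by (simp add: power2_eq_square field_simps)
    finally show ?thesis .
  qed
  have "(\<integral>\<^sup>+y. ennreal (exp (l * f y)) \<partial>\<mu>) \<le> (\<integral>\<^sup>+y. ennreal (exp (l * ?m)) * ennreal (?b y) \<partial>\<mu>)"
  proof (rule nn_integral_mono_AE)
    show "AE y in \<mu>. ennreal (exp (l * f y)) \<le> ennreal (exp (l * ?m)) * ennreal (?b y)"
      using AE_le_integral_add[OF f R]
    proof eventually_elim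
      case (elim y)
      have "l * (f y - ?m) \<le> l * R" using elim l by (intro mult_left_mono) auto
      then have "exp (l * (f y - ?m)) \<le> ?b y"
        using exp_le_quadratic[of "l * (f y - ?m)"] l by (simp add: power_mult_distrib)
      then have "exp (l * ?m) * exp (l * (f y - ?m)) \<le> exp (l * ?m) * ?b y"
        by (intro mult_left_mono) auto
      also have "exp (l * ?m) * exp (l * (f y - ?m)) = exp (l * f y)"
        by (simp add: exp_add[symmetric] algebra_simps)
      finally show ?case
        using nonneg by (simp add: ennreal_mult[symmetric] ennreal_leI del: ennreal_plus)
    qed
  qed
  also have "\<dots> = ennreal (exp (l * ?m)) * (\<integral>\<^sup>+y. ennreal (?b y) \<partial>\<mu>)"
    by (rule nn_integral_cmult) simp
  also have "(\<integral>\<^sup>+y. ennreal (?b y) \<partial>\<mu>) = ennreal (\<integral>y. ?b y \<partial>\<mu>)"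
    using ib nonneg by (intro nn_integral_eq_integral) auto
  also have "ennreal (exp (l * ?m)) * \<dots> = ennreal (exp (l * ?m) * (\<integral>y. ?b y \<partial>\<mu>))"
    using nonneg by (simp add: ennreal_mult' )
  also have "\<dots> \<le> ennreal (exp (l * ?m + l\<^sup>2 * V))"
  proof (rule ennreal_leI)
    have "(\<integral>y. ?b y \<partial>\<mu>) \<le> 1 + l\<^sup>2 * V"
      unfolding b using V by (intro add_left_mono mult_left_mono) auto
    also have "\<dots> \<le> exp (l\<^sup>2 * V)" by (rule exp_ge_add_one_self)
    finally show "exp (l * ?m) * (\<integral>y. ?b y \<partial>\<mu>) \<le> exp (l * ?m + l\<^sup>2 * V)"
      by (simp add: exp_add)
  qed
  finally show ?thesis .
qed

lemma ennreal_variance_cmult: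
  "ennreal_variance \<mu> (\<lambda>x. c * f x) = ennreal (c\<^sup>2) * ennreal_variance \<mu> f"
  if [measurable]: "f \<in> borel_measurable borel"
proof -
  have "(c * f y - c * (\<integral>z. f z \<partial>\<mu>))\<^sup>2 = c\<^sup>2 * (f y - (\<integral>z. f z \<partial>\<mu>))\<^sup>2" for y
    by (simp add: power2_eq_square algebra_simps)
  then show ?thesis
    by (simp add: ennreal_variance_def ennreal_mult nn_integral_cmult)
qed

end

subsection \<open>Curvature and variance\<close>

text \<open>The easy half of Kantorovich duality: integrate the Lipschitz bound for
  \<open>g (fst p) - g (snd p)\<close> against an arbitrary coupling.\<close>

lemma integral_diff_le_transport_dist:
  fixes g :: "'a::polish_space \<Rightarrow> real"
  assumes "moment_prob_space \<mu>" "moment_prob_space \<mu>'"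
    and g: "L-lipschitz_on UNIV g" and L: "0 < L"
  shows "ennreal ((\<integral>x. g x \<partial>\<mu>) - (\<integral>x. g x \<partial>\<mu>')) \<le> ennreal L * transport_dist \<mu> \<mu>'"
proof -
  interpret a: moment_prob_space \<mu> by fact
  interpret b: moment_prob_space \<mu>' by fact
  let ?d = "(\<integral>x. g x \<partial>\<mu>) - (\<integral>x. g x \<partial>\<mu>')"
  have [measurable]: "g \<in> borel_measurable borel" using g by (rule lipschitz_on_borel_measurable)
  \<comment> \<open>Dividing by \<open>L\<close> leaves the bare infimum on the right, so each
    coupling can be treated separately.\<close>
  have "ennreal ?d / ennreal L \<le> transport_dist \<mu> \<mu>'"
    unfolding transport_dist_def
  proof (rule INF_greatest)
    fix \<xi> assume "\<xi> \<in> couplings \<mu> \<mu>'"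
    then have [measurable_cong]: "sets \<xi> = sets (borel \<Otimes>\<^sub>M borel)"
      and m: "distr \<xi> borel fst = \<mu>" "distr \<xi> borel snd = \<mu>'"
      by (auto simp: couplings_def)
    have "integrable (distr \<xi> borel fst) g" "integrable (distr \<xi> borel snd) g"
      unfolding m using g by (auto intro: a.integrable_lipschitz b.integrable_lipschitz)
    then have i: "integrable \<xi> (\<lambda>p. g (fst p))" "integrable \<xi> (\<lambda>p. g (snd p))"
      by (auto simp: integrable_distr_eq)
    have "?d = (\<integral>p. g (fst p) - g (snd p) \<partial>\<xi>)"
      using i by (simp add: m(1)[symmetric] m(2)[symmetric] integral_distr)
    also have "ennreal \<dots> \<le> (\<integral>\<^sup>+p. ennreal (g (fst p) - g (snd p)) \<partial>\<xi>)"
    proof -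
      \<comment> \<open>\<open>ennreal\<close> sends negative reals to 0, so the comparison passes
        through the positive part.\<close>
      have "ennreal (\<integral>p. g (fst p) - g (snd p) \<partial>\<xi>) \<le> ennreal (\<integral>p. max 0 (g (fst p) - g (snd p)) \<partial>\<xi>)"
        using i by (intro ennreal_leI integral_mono) auto
      also have "\<dots> = (\<integral>\<^sup>+p. ennreal (max 0 (g (fst p) - g (snd p))) \<partial>\<xi>)"
        using i by (intro nn_integral_eq_integral[symmetric]) auto
      finally show ?thesis by (simp add: ennreal_max_0)
    qed
    also have "\<dots> \<le> (\<integral>\<^sup>+p. ennreal L * ennreal (dist (fst p) (snd p)) \<partial>\<xi>)"
      using lipschitz_onD[OF g] L
      by (intro nn_integral_mono) (auto simp: ennreal_mult[symmetric] dist_real_def abs_le_iff intro!: ennreal_leI)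
    also have "\<dots> = ennreal L * (\<integral>\<^sup>+p. ennreal (dist (fst p) (snd p)) \<partial>\<xi>)"
      by (intro nn_integral_cmult) simp
    finally show "ennreal ?d / ennreal L \<le> (\<integral>\<^sup>+ (x, y). ennreal (dist x y) \<partial>\<xi>)"
      using L by (intro divide_le_posI_ennreal) (auto simp: case_prod_beta')
  qed
  then have "ennreal L * (ennreal ?d / ennreal L) \<le> ennreal L * transport_dist \<mu> \<mu>'"
    by (rule mult_left_mono) simp
  then show ?thesis
    using L by (simp add: ennreal_times_divide ennreal_mult_divide_eq mult.commute[of "ennreal L"])
qed

text \<open>An infinite transport distance would make the curvature -\<infinity>, so the distance is
  a real \<open>T\<close>, and \<open>T \<ge> 0\<close> forces \<kappa> \<le> 1. This takes two
  distinct points, which is why one-point spaces are treated apart at the end.\<close>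

lemma ricci_curvature_geD:
  assumes "ereal \<kappa> \<le> ricci_curvature m x y" "x \<noteq> y"
  shows "transport_dist (m x) (m y) \<le> ennreal ((1 - \<kappa>) * dist x y)" "\<kappa> \<le> 1"
proof -
  have d: "0 < dist x y" using assms by simp
  have "transport_dist (m x) (m y) \<noteq> \<top>"
    using assms d by (auto simp: ricci_curvature_def one_ereal_def)
  then obtain T where T: "transport_dist (m x) (m y) = ennreal T" "0 \<le> T"
    by (cases "transport_dist (m x) (m y)") auto
  have "\<kappa> \<le> 1 - T / dist x y"
    using assms(1) d by (simp add: ricci_curvature_def T one_ereal_def)
  moreover have "0 \<le> T / dist x y" using T d by simp
  ultimately have "\<kappa> \<le> 1" by simp
  moreover have "T \<le> (1 - \<kappa>) * dist x y" using \<open>\<kappa> \<le> 1 - T / dist x y\<close> d by (simp add: field_simps)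
  ultimately show "transport_dist (m x) (m y) \<le> ennreal ((1 - \<kappa>) * dist x y)" "\<kappa> \<le> 1"
    by (auto simp: T intro!: ennreal_leI)
qed

lemma sqrt_ennreal_power2: "(sqrt_ennreal a)\<^sup>2 = a"
  by (cases a) (auto simp: sqrt_ennreal_def ennreal_power power_top_ennreal)

text \<open>For positive finite \<open>s\<close> and \<open>V\<close> the quotient
  \<open>D_sq_at\<close> collapses to \<open>V / \<kappa>\<close>, and \<open>V\<close> dominates
  the variance of \<open>f\<close>. The rest concerns \<open>ennreal\<close> division when
  \<open>s\<close> or \<open>V\<close> is 0 or \<top>.\<close>

lemma ennreal_variance_le_D_sq_at:
  assumes "moment_prob_space (m x)" and \<kappa>: "0 < \<kappa>"
    and bdd: "ennreal_diameter (support (m x)) < \<top>"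
    and D: "D_sq_at m \<kappa> x < \<top>"
    and f: "1-lipschitz_on UNIV f"
  shows "ennreal_variance (m x) f \<le> ennreal \<kappa> * D_sq_at m \<kappa> x"
proof -
  interpret moment_prob_space "m x" by fact
  define s where "s = (spread m x)\<^sup>2"
  define V where "V = (SUP f\<in>{f. 1-lipschitz_on UNIV f}. ennreal_variance (m x) f)"
  have s: "s = (\<integral>\<^sup>+ y. \<integral>\<^sup>+ z. ennreal ((dist y z)\<^sup>2) \<partial>m x \<partial>m x) / 2"
    by (simp add: s_def spread_def sqrt_ennreal_power2)
  have D_eq: "D_sq_at m \<kappa> x = s / (s / V * ennreal \<kappa>)"
    by (simp add: D_sq_at_def local_dimension_def s_def V_def)
  have fV: "ennreal_variance (m x) f \<le> V"
    unfolding V_def using f by (intro SUP_upper) simp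
  have "s < \<top>"
  proof -
    obtain R where R: "ennreal_diameter (support (m x)) = ennreal R" "0 \<le> R"
      using bdd by (cases "ennreal_diameter (support (m x))") auto
    have "AE y in m x. (\<integral>\<^sup>+ z. ennreal ((dist y z)\<^sup>2) \<partial>m x) \<le> ennreal (R\<^sup>2)"
      using AE_dist_le[OF eq_refl[OF R(1)] R(2)]
    proof eventually_elim
      case (elim y)
      have "(\<integral>\<^sup>+ z. ennreal ((dist y z)\<^sup>2) \<partial>m x) \<le> (\<integral>\<^sup>+ z. ennreal (R\<^sup>2) \<partial>m x)"
      proof (rule nn_integral_mono_AE)
        show "AE z in m x. ennreal ((dist y z)\<^sup>2) \<le> ennreal (R\<^sup>2)"
          using elim by eventually_elim (auto intro!: ennreal_leI power_mono)
      qed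
      then show ?case by (simp add: emeasure_eq_measure)
    qed
    then have "(\<integral>\<^sup>+ y. \<integral>\<^sup>+ z. ennreal ((dist y z)\<^sup>2) \<partial>m x \<partial>m x) \<le> (\<integral>\<^sup>+ y. ennreal (R\<^sup>2) \<partial>m x)"
      by (rule nn_integral_mono_AE)
    also have "\<dots> < \<top>" by (simp add: emeasure_eq_measure)
    finally show ?thesis
      by (auto simp: s ennreal_divide_eq_top_iff less_top[symmetric])
  qed
  show ?thesis
  proof (cases "s = 0")
    case True
    have [measurable]: "f \<in> borel_measurable borel" using f by (rule lipschitz_on_borel_measurable)
    \<comment> \<open>Zero spread means a Dirac mass: for some \<open>y\<close>, almost every
      \<open>z\<close> equals \<open>y\<close>, so \<open>f\<close> is almost surely
      constant.\<close>
    have "(\<integral>\<^sup>+ y. \<integral>\<^sup>+ z. ennreal ((dist y z)\<^sup>2) \<partial>m x \<partial>m x) = 0"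
      using True by (simp add: s)
    then have "AE y in m x. (\<integral>\<^sup>+ z. ennreal ((dist y z)\<^sup>2) \<partial>m x) = 0"
      by (subst (asm) nn_integral_0_iff_AE) auto
    moreover have "\<exists>y. P y" if "AE y in m x. P y" for P
      using that AE_False by (cases "\<exists>y. P y") auto
    ultimately obtain y where "(\<integral>\<^sup>+ z. ennreal ((dist y z)\<^sup>2) \<partial>m x) = 0" by meson
    then have AE: "AE z in m x. y = z"
      by (subst (asm) nn_integral_0_iff_AE) auto
    have "(\<integral>z. f z \<partial>m x) = (\<integral>z. f y \<partial>m x)"
      using AE by (intro integral_cong_AE) auto
    then have "ennreal_variance (m x) f = (\<integral>\<^sup>+z. 0 \<partial>m x)"
      unfolding ennreal_variance_def using AE by (intro nn_integral_cong_AE) auto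
    then show ?thesis by simp
  next
    case False
    with \<open>s < \<top>\<close> obtain r where r: "s = ennreal r" "0 < r"
      by (cases s) auto
    consider "V = 0" | "V = \<top>" | v where "V = ennreal v" "0 < v"
      by (cases V) (auto simp: less_le)
    then show ?thesis
    proof cases
      case 1
      then show ?thesis using fV by simp
    next
      case 2
      \<comment> \<open>Here \<open>s / V = 0\<close>, and dividing the positive \<open>s\<close> by
        0 gives \<top>, against the finiteness of \<open>D_sq_at\<close>.\<close>
      then show ?thesis using D False by (simp add: D_eq)
    next
      case 3
      then have "ennreal \<kappa> * D_sq_at m \<kappa> x = V"
        using r \<kappa> by (simp add: D_eq divide_ennreal ennreal_mult[symmetric])
      then show ?thesis using fV by simp
    qed
  qed
qed

subsection \<open>Exponential moments of the invariant distribution\<close>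

text \<open>Curvature appears here as the contraction \<open>transport_le\<close>, for equal points
  too.\<close>

locale contracting_walk = nu: moment_prob_space \<nu> for \<nu> :: "'a::polish_space measure" +
  fixes m :: "'a \<Rightarrow> 'a measure" and \<kappa> :: real
  assumes walk_measurable [measurable]: "m \<in> borel \<rightarrow>\<^sub>M subprob_algebra borel"
    and walk_moment: "\<And>x. moment_prob_space (m x)"
    and invariant: "bind \<nu> m = \<nu>"
    and curv_pos: "0 < \<kappa>" and curv_le_1: "\<kappa> \<le> 1"
    and transport_le: "\<And>x y. transport_dist (m x) (m y) \<le> ennreal ((1 - \<kappa>) * dist x y)"
begin

section \<open>The averaging operator of the walk\<close>

definition average :: "('a \<Rightarrow> real) \<Rightarrow> 'a \<Rightarrow> real" where
  "average g x = (\<integral>y. g y \<partial>m x)"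

text \<open>Duality gives a one-sided estimate for each ordered pair; exchanging the points gives
  the absolute value.\<close>

lemma lipschitz_average:
  assumes g: "L-lipschitz_on UNIV g" and L: "0 < L"
  shows "((1 - \<kappa>) * L)-lipschitz_on UNIV (average g)"
proof (rule lipschitz_onI)
  have le: "average g x - average g y \<le> (1 - \<kappa>) * L * dist x y" for x y
  proof -
    have "ennreal (average g x - average g y) \<le> ennreal L * transport_dist (m x) (m y)"
      unfolding average_def by (rule integral_diff_le_transport_dist[OF walk_moment walk_moment g L])
    also have "\<dots> \<le> ennreal L * ennreal ((1 - \<kappa>) * dist x y)"
      by (intro mult_left_mono transport_le) simp
    also have "\<dots> = ennreal ((1 - \<kappa>) * L * dist x y)"
      using L by (simp add: ennreal_mult'[symmetric] mult_ac)
    finally show ?thesis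
      using L curv_le_1 by (subst (asm) ennreal_le_iff) auto
  qed
  show "dist (average g x) (average g y) \<le> (1 - \<kappa>) * L * dist x y" for x y
    using le[of x y] le[of y x] by (auto simp: dist_real_def abs_le_iff dist_commute)
  show "0 \<le> (1 - \<kappa>) * L" using L curv_le_1 by simp
qed

lemma nn_integral_invariant:
  assumes "g \<in> borel_measurable borel"
  shows "(\<integral>\<^sup>+x. g x \<partial>\<nu>) = (\<integral>\<^sup>+x. \<integral>\<^sup>+y. g y \<partial>m x \<partial>\<nu>)"
proof -
  have "(\<integral>\<^sup>+x. g x \<partial>bind \<nu> m) = (\<integral>\<^sup>+x. \<integral>\<^sup>+y. g y \<partial>m x \<partial>\<nu>)"
    using assms by (rule nn_integral_bind) measurable
  then show ?thesis by (simp add: invariant)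
qed

text \<open>Invariance settles nonnegative functions through \<open>nn_integral_invariant\<close>;
  in general \<open>g\<close> splits into its positive and negative parts, which are still Lipschitz
  and hence integrable.\<close>

lemma integral_average:
  assumes g: "L-lipschitz_on UNIV g" and L: "0 < L"
  shows "(\<integral>x. average g x \<partial>\<nu>) = (\<integral>x. g x \<partial>\<nu>)"
proof -
  have *: "(\<integral>x. average h x \<partial>\<nu>) = (\<integral>x. h x \<partial>\<nu>)"
    if h: "L-lipschitz_on UNIV h" "\<And>x. 0 \<le> h x" for h
  proof -
    have [measurable]: "h \<in> borel_measurable borel" using h(1) by (rule lipschitz_on_borel_measurable)
    have nn: "0 \<le> average h x" for x using h(2) by (simp add: average_def)
    have "ennreal (\<integral>x. h x \<partial>\<nu>) = (\<integral>\<^sup>+x. ennreal (h x) \<partial>\<nu>)"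
      using h by (intro nn_integral_eq_integral[symmetric] nu.integrable_lipschitz[of L]) auto
    also have "\<dots> = (\<integral>\<^sup>+x. \<integral>\<^sup>+y. ennreal (h y) \<partial>m x \<partial>\<nu>)"
      by (rule nn_integral_invariant) simp
    also have "\<dots> = (\<integral>\<^sup>+x. ennreal (average h x) \<partial>\<nu>)"
      unfolding average_def using h
      by (intro nn_integral_cong nn_integral_eq_integral
          moment_prob_space.integrable_lipschitz[OF walk_moment, of L]) auto
    also have "\<dots> = ennreal (\<integral>x. average h x \<partial>\<nu>)"
      using nn h L
      by (intro nn_integral_eq_integral nu.integrable_lipschitz[OF lipschitz_average[of L]]) auto
    finally show ?thesis using h nn by (simp add: integral_nonneg_AE)
  qed
  let ?p = "\<lambda>x. max (g x) 0" and ?n = "\<lambda>x. max (- g x) 0"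
  have p: "L-lipschitz_on UNIV ?p" using g by (rule lipschitz_on_max_min)
  have n: "L-lipschitz_on UNIV ?n"
    using g by (intro lipschitz_on_max_min) (auto simp: lipschitz_on_def dist_real_def abs_minus_commute)
  have g_eq: "?p x - ?n x = g x" for x by auto
  have "average g x = average ?p x - average ?n x" for x
  proof -
    have "average g x = (\<integral>y. ?p y - ?n y \<partial>m x)" by (simp only: average_def g_eq)
    also have "\<dots> = average ?p x - average ?n x"
      unfolding average_def
      by (intro Bochner_Integration.integral_diff
        moment_prob_space.integrable_lipschitz[OF walk_moment p]
        moment_prob_space.integrable_lipschitz[OF walk_moment n])
    finally show ?thesis .
  qed
  then have "(\<integral>x. average g x \<partial>\<nu>) = (\<integral>x. average ?p x \<partial>\<nu>) - (\<integral>x. average ?n x \<partial>\<nu>)"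
    using nu.integrable_lipschitz[OF lipschitz_average[OF p L]]
      nu.integrable_lipschitz[OF lipschitz_average[OF n L]] by simp
  also have "\<dots> = (\<integral>x. ?p x \<partial>\<nu>) - (\<integral>x. ?n x \<partial>\<nu>)"
    using *[OF p] *[OF n] by simp
  also have "\<dots> = (\<integral>x. ?p x - ?n x \<partial>\<nu>)"
    using nu.integrable_lipschitz[OF p] nu.integrable_lipschitz[OF n] by simp
  finally show ?thesis by (simp only: g_eq)
qed

end

section \<open>Iterated averaging with a variance correction\<close>

locale variance_bounded_walk = contracting_walk +
  fixes D :: "'a \<Rightarrow> real" and C R l :: real
  assumes D_lipschitz: "C-lipschitz_on UNIV D" and D_nonneg: "\<And>x. 0 \<le> D x"
    and variance_le: "\<And>f x. 1-lipschitz_on UNIV f \<Longrightarrow> ennreal_variance (m x) f \<le> ennreal (\<kappa> * D x)"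
    and jump_le: "\<And>x. AE y in m x. AE z in m x. dist y z \<le> R"
    and l_pos: "0 < l" and l_C: "2 * l * C \<le> 1" and l_R: "l * R \<le> 1"
begin

text \<open>Averaging alone contracts by \<open>1 - \<kappa>\<close>; the slower rate leaves
  \<open>\<kappa> / 2\<close> to pay for the slope of the \<open>D\<close> term in
  \<open>iter\<close>.\<close>

definition lip_const :: "nat \<Rightarrow> real" where
  "lip_const k = (1 - \<kappa> / 2) ^ k"

text \<open>\<open>\<kappa> * D x * (lip_const k)\<^sup>2\<close> bounds the variance of
  \<open>iter g k\<close> under \<open>m x\<close>; times \<open>l\<close> it is the price of moving
  the average inside the exponential.\<close>

fun iter :: "('a \<Rightarrow> real) \<Rightarrow> nat \<Rightarrow> 'a \<Rightarrow> real" where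
  "iter g 0 = g"
| "iter g (Suc k) = (\<lambda>x. average (iter g k) x + l * \<kappa> * D x * (lip_const k)\<^sup>2)"

lemma lip_const: "0 < lip_const k" "lip_const k \<le> 1"
proof -
  have "0 < 1 - \<kappa> / 2" "1 - \<kappa> / 2 \<le> 1" using curv_pos curv_le_1 by auto
  then show "0 < lip_const k" "lip_const k \<le> 1"
    by (auto simp: lip_const_def power_le_one)
qed

lemma iter_lipschitz:
  assumes "1-lipschitz_on UNIV g"
  shows "(lip_const k)-lipschitz_on UNIV (iter g k)"
proof (induction k)
  case 0
  then show ?case using assms by (simp add: lip_const_def)
next
  case (Suc k)
  let ?a = "lip_const k"
  have A: "((1 - \<kappa>) * ?a)-lipschitz_on UNIV (average (iter g k))"
    using Suc lip_const(1) by (rule lipschitz_average)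
  have C0: "0 \<le> C" using D_lipschitz by (rule lipschitz_on_nonneg)
  \<comment> \<open>As \<open>2 * l * C \<le> 1\<close> and \<open>?a \<le> 1\<close>, the
    correction uses up at most half of the contraction.\<close>
  have "l * \<kappa> * C * ?a\<^sup>2 = (2 * l * C) * (\<kappa> / 2 * ?a) * ?a" by (simp add: power2_eq_square)
  also have "\<dots> \<le> 1 * (\<kappa> / 2 * ?a) * 1"
    using l_C l_pos C0 curv_pos lip_const[of k] by (intro mult_mono) auto
  finally have le: "l * \<kappa> * C * ?a\<^sup>2 \<le> \<kappa> / 2 * ?a" by simp
  have "(l * \<kappa> * C * ?a\<^sup>2)-lipschitz_on UNIV (\<lambda>x. l * \<kappa> * D x * ?a\<^sup>2)"
  proof (rule lipschitz_onI)
    fix x y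
    have "dist (l * \<kappa> * D x * ?a\<^sup>2) (l * \<kappa> * D y * ?a\<^sup>2) = l * \<kappa> * ?a\<^sup>2 * dist (D x) (D y)"
      using l_pos curv_pos
      by (simp add: dist_real_def left_diff_distrib[symmetric] right_diff_distrib[symmetric] abs_mult)
    also have "\<dots> \<le> l * \<kappa> * ?a\<^sup>2 * (C * dist x y)"
      using l_pos curv_pos lipschitz_onD[OF D_lipschitz] by (intro mult_left_mono) auto
    finally show "dist (l * \<kappa> * D x * ?a\<^sup>2) (l * \<kappa> * D y * ?a\<^sup>2) \<le> l * \<kappa> * C * ?a\<^sup>2 * dist x y"
      by (simp add: mult_ac)
  qed (use l_pos curv_pos C0 in auto)
  from lipschitz_on_add[OF A this]
  have "((1 - \<kappa>) * ?a + l * \<kappa> * C * ?a\<^sup>2)-lipschitz_on UNIV (iter g (Suc k))" by simp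
  moreover have "(1 - \<kappa>) * ?a + \<kappa> / 2 * ?a = lip_const (Suc k)"
    by (simp add: lip_const_def algebra_simps)
  ultimately show ?case
    using le by (elim lipschitz_on_le) simp
qed

text \<open>The corrections form a geometric series of ratio
  \<open>q = (1 - \<kappa> / 2)\<^sup>2\<close>, and
  \<open>1 - q = \<kappa> * (1 - \<kappa> / 4) \<ge> 3 / 4 * \<kappa>\<close> because \<kappa> \<le>
  1; hence the factor 4/3.\<close>

lemma integral_iter_le:
  assumes "1-lipschitz_on UNIV g"
  shows "(\<integral>x. iter g k x \<partial>\<nu>)
    \<le> (\<integral>x. g x \<partial>\<nu>) + 4 / 3 * l * (\<integral>x. D x \<partial>\<nu>) * (1 - (lip_const k)\<^sup>2)"
proof (induction k)
  case 0
  then show ?case by (simp add: lip_const_def)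
next
  case (Suc k)
  let ?a = "lip_const k" and ?D = "\<integral>x. D x \<partial>\<nu>"
  have D0: "0 \<le> ?D" using D_nonneg by simp
  note L = iter_lipschitz[OF assms, of k]
  have "(\<integral>x. iter g (Suc k) x \<partial>\<nu>) = (\<integral>x. average (iter g k) x \<partial>\<nu>) + l * \<kappa> * ?D * ?a\<^sup>2"
    using nu.integrable_lipschitz[OF D_lipschitz]
      nu.integrable_lipschitz[OF lipschitz_average[OF L lip_const(1)]] by simp
  also have "(\<integral>x. average (iter g k) x \<partial>\<nu>) = (\<integral>x. iter g k x \<partial>\<nu>)"
    using L lip_const(1) by (rule integral_average)
  also have "\<dots> + l * \<kappa> * ?D * ?a\<^sup>2
      \<le> (\<integral>x. g x \<partial>\<nu>) + 4 / 3 * l * ?D * (1 - ?a\<^sup>2) + l * \<kappa> * ?D * ?a\<^sup>2"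
    using Suc by simp
  also have "\<dots> \<le> (\<integral>x. g x \<partial>\<nu>) + 4 / 3 * l * ?D * (1 - (lip_const (Suc k))\<^sup>2)"
  proof -
    \<comment> \<open>The last factor is the slack \<open>4 / 3 * (1 - q) - \<kappa>\<close> with
      \<open>q = (1 - \<kappa> / 2)\<^sup>2\<close>.\<close>
    have "0 \<le> l * ?D * ?a\<^sup>2 * (\<kappa> * (1 - \<kappa>) / 3)"
      using l_pos D0 curv_pos curv_le_1 by simp
    also have "\<dots> = 4 / 3 * l * ?D * (1 - (lip_const (Suc k))\<^sup>2)
        - (4 / 3 * l * ?D * (1 - ?a\<^sup>2) + l * \<kappa> * ?D * ?a\<^sup>2)"
      by (simp add: lip_const_def power2_eq_square field_simps)
    finally show ?thesis by simp
  qed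
  finally show ?case .
qed

text \<open>\<open>variance_le\<close> speaks of 1-Lipschitz functions, so it is applied to
  \<open>iter g k\<close> divided by \<open>lip_const k\<close>; scaling back gives the factor
  \<open>(lip_const k)\<^sup>2\<close>.\<close>

lemma nn_integral_exp_iter_le:
  assumes "1-lipschitz_on UNIV g"
  shows "(\<integral>\<^sup>+y. ennreal (exp (l * iter g k y)) \<partial>m x) \<le> ennreal (exp (l * iter g (Suc k) x))"
proof -
  interpret mx: moment_prob_space "m x" by (rule walk_moment)
  let ?a = "lip_const k"
  note L = iter_lipschitz[OF assms, of k]
  have a: "0 < ?a" by (rule lip_const)
  have scaled: "1-lipschitz_on UNIV (\<lambda>y. inverse ?a * iter g k y)"
  proof (rule lipschitz_onI)
    fix y z
    have "dist (inverse ?a * iter g k y) (inverse ?a * iter g k z)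
        = inverse ?a * dist (iter g k y) (iter g k z)"
      using a by (simp add: dist_real_def right_diff_distrib[symmetric] abs_mult)
    also have "\<dots> \<le> inverse ?a * (?a * dist y z)"
      using a lipschitz_onD[OF L] by (intro mult_left_mono) auto
    finally show "dist (inverse ?a * iter g k y) (inverse ?a * iter g k z) \<le> 1 * dist y z"
      using a by (simp add: mult.assoc[symmetric])
  qed simp
  have "ennreal_variance (m x) (iter g k)
      = ennreal_variance (m x) (\<lambda>y. ?a * (inverse ?a * iter g k y))"
    using a by (simp add: mult.assoc[symmetric])
  also have "\<dots> = ennreal (?a\<^sup>2) * ennreal_variance (m x) (\<lambda>y. inverse ?a * iter g k y)"
    using lipschitz_on_borel_measurable[OF scaled] by (rule mx.ennreal_variance_cmult)
  also have "\<dots> \<le> ennreal (?a\<^sup>2) * ennreal (\<kappa> * D x)"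
    using variance_le[OF scaled] by (rule mult_left_mono) simp
  also have "\<dots> = ennreal (\<kappa> * D x * ?a\<^sup>2)"
    by (subst ennreal_mult'[symmetric]) (simp_all add: mult_ac)
  finally have var: "ennreal_variance (m x) (iter g k) \<le> ennreal (\<kappa> * D x * ?a\<^sup>2)" .
  have "(\<integral>\<^sup>+y. ennreal (exp (l * iter g k y)) \<partial>m x)
      \<le> ennreal (exp (l * (\<integral>y. iter g k y \<partial>m x) + l\<^sup>2 * (\<kappa> * D x * ?a\<^sup>2)))"
    using L lip_const(2)[of k] jump_le var l_pos l_R curv_pos D_nonneg[of x]
    by (intro mx.nn_integral_exp_le[where R = R]) (auto intro: lipschitz_on_le)
  also have "l * (\<integral>y. iter g k y \<partial>m x) + l\<^sup>2 * (\<kappa> * D x * ?a\<^sup>2) = l * iter g (Suc k) x"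
    by (simp add: average_def power2_eq_square algebra_simps)
  finally show ?thesis .
qed

text \<open>Invariance inserts one step of the walk, which \<open>nn_integral_exp_iter_le\<close>
  turns into the next iterate. The cap survives because the inner integral is also at most
  \<open>exp (l * b)\<close>; it will supply the majorant for the limit in \<open>k\<close>.\<close>

lemma nn_integral_exp_le_iter:
  assumes g: "1-lipschitz_on UNIV g" and b: "\<And>x. g x \<le> b"
  shows "(\<integral>\<^sup>+x. ennreal (exp (l * g x)) \<partial>\<nu>)
    \<le> (\<integral>\<^sup>+x. ennreal (exp (l * min (iter g k x) b)) \<partial>\<nu>)"
proof (induction k)
  case 0
  then show ?case using b by (simp add: min_absorb1)
next
  case (Suc k)
  have [measurable]: "iter g k \<in> borel_measurable borel" for k
    using iter_lipschitz[OF g] by (rule lipschitz_on_borel_measurable)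
  have "(\<integral>\<^sup>+x. ennreal (exp (l * min (iter g k x) b)) \<partial>\<nu>)
      = (\<integral>\<^sup>+x. \<integral>\<^sup>+y. ennreal (exp (l * min (iter g k y) b)) \<partial>m x \<partial>\<nu>)"
    by (rule nn_integral_invariant) simp
  also have "\<dots> \<le> (\<integral>\<^sup>+x. ennreal (exp (l * min (iter g (Suc k) x) b)) \<partial>\<nu>)"
  proof (rule nn_integral_mono)
    fix x
    interpret mx: moment_prob_space "m x" by (rule walk_moment)
    have "(\<integral>\<^sup>+y. ennreal (exp (l * min (iter g k y) b)) \<partial>m x) \<le> (\<integral>\<^sup>+y. ennreal (exp (l * iter g k y)) \<partial>m x)"
      using l_pos by (intro nn_integral_mono ennreal_leI) auto
    also note nn_integral_exp_iter_le[OF g]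
    finally have 1: "(\<integral>\<^sup>+y. ennreal (exp (l * min (iter g k y) b)) \<partial>m x) \<le> ennreal (exp (l * iter g (Suc k) x))" .
    have "(\<integral>\<^sup>+y. ennreal (exp (l * min (iter g k y) b)) \<partial>m x) \<le> (\<integral>\<^sup>+y. ennreal (exp (l * b)) \<partial>m x)"
      using l_pos by (intro nn_integral_mono ennreal_leI) auto
    also have "\<dots> = ennreal (exp (l * b))" by (simp add: mx.emeasure_eq_measure)
    finally have 2: "(\<integral>\<^sup>+y. ennreal (exp (l * min (iter g k y) b)) \<partial>m x) \<le> ennreal (exp (l * b))" .
    show "(\<integral>\<^sup>+y. ennreal (exp (l * min (iter g k y) b)) \<partial>m x) \<le> ennreal (exp (l * min (iter g (Suc k) x) b))"
      using 1 2 by (cases "iter g (Suc k) x \<le> b") (auto simp: min_def simp del: iter.simps)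
  qed
  finally show ?case using Suc by (rule order_trans[rotated])
qed

text \<open>An iterate exceeds its mean by at most \<open>lip_const k * W x\<close>, which tends to
  0 pointwise; the cap at \<open>b\<close> permits dominated convergence and is dropped at the end
  by \<open>min c b \<le> c\<close>.\<close>

lemma nn_integral_exp_invariant_le:
  assumes g: "1-lipschitz_on UNIV g" and b: "\<And>x. g x \<le> b"
  shows "(\<integral>\<^sup>+x. ennreal (exp (l * g x)) \<partial>\<nu>)
    \<le> ennreal (exp (l * (\<integral>x. g x \<partial>\<nu>) + 4 / 3 * l\<^sup>2 * (\<integral>x. D x \<partial>\<nu>)))"
proof -
  \<comment> \<open>\<open>c\<close> bounds the mean of every iterate, and \<open>W x\<close> is the
    mean distance from \<open>x\<close>.\<close>
  define c where "c = (\<integral>x. g x \<partial>\<nu>) + 4 / 3 * l * (\<integral>x. D x \<partial>\<nu>)"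
  define W where "W x = (\<integral>y. dist x y \<partial>\<nu>)" for x
  have D0: "0 \<le> (\<integral>x. D x \<partial>\<nu>)" using D_nonneg by simp
  have dist_lip: "1-lipschitz_on UNIV (dist x)" for x :: 'a
  proof (rule lipschitz_onI)
    show "dist (dist x y) (dist x z) \<le> 1 * dist y z" for y z
      using abs_dist_diff_le[of y x z] by (simp add: dist_real_def dist_commute)
  qed simp
  have "1-lipschitz_on UNIV W"
  proof (rule lipschitz_onI)
    fix x y
    have "W x \<le> W y + dist x y" for x y
    proof -
      have "W x \<le> (\<integral>z. dist x y + dist y z \<partial>\<nu>)"
        unfolding W_def using nu.integrable_lipschitz[OF dist_lip]
        by (intro integral_mono) (auto simp: dist_triangle)
      also have "\<dots> = W y + dist x y"
        unfolding W_def using nu.integrable_lipschitz[OF dist_lip] by simp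
      finally show ?thesis .
    qed
    from this[of x y] this[of y x] show "dist (W x) (W y) \<le> 1 * dist x y"
      by (auto simp: dist_real_def abs_le_iff dist_commute)
  qed simp
  then have [measurable]: "W \<in> borel_measurable borel" by (rule lipschitz_on_borel_measurable)
  have iter_le: "iter g k x \<le> c + lip_const k * W x" for k x
  proof -
    note L = iter_lipschitz[OF g, of k]
    have int: "integrable \<nu> (iter g k)" using L by (rule nu.integrable_lipschitz)
    have "iter g k x - (\<integral>y. iter g k y \<partial>\<nu>) = (\<integral>y. iter g k x - iter g k y \<partial>\<nu>)"
      using int by simp
    also have "\<dots> \<le> (\<integral>y. lip_const k * dist x y \<partial>\<nu>)"
      using lipschitz_onD[OF L] int nu.integrable_lipschitz[OF dist_lip]
      by (intro integral_mono) (auto simp: dist_real_def abs_le_iff)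
    also have "\<dots> = lip_const k * W x" by (simp add: W_def)
    finally have "iter g k x \<le> (\<integral>y. iter g k y \<partial>\<nu>) + lip_const k * W x" by simp
    also have "(\<integral>y. iter g k y \<partial>\<nu>) \<le> c"
    proof -
      have "4 / 3 * l * (\<integral>x. D x \<partial>\<nu>) * (1 - (lip_const k)\<^sup>2) \<le> 4 / 3 * l * (\<integral>x. D x \<partial>\<nu>) * 1"
        using l_pos D0 by (intro mult_left_mono) auto
      then show ?thesis using integral_iter_le[OF g, of k] by (simp add: c_def)
    qed
    finally show ?thesis by simp
  qed
  let ?u = "\<lambda>k x. exp (l * min (c + lip_const k * W x) b)"
  have lim: "(\<lambda>k. \<integral>x. ?u k x \<partial>\<nu>) \<longlonglongrightarrow> (\<integral>x. exp (l * min c b) \<partial>\<nu>)"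
  proof (rule integral_dominated_convergence)
    have "lip_const \<longlonglongrightarrow> 0"
      unfolding lip_const_def using curv_pos curv_le_1 by (intro LIMSEQ_power_zero) auto
    then have "(\<lambda>k. ?u k x) \<longlonglongrightarrow> exp (l * min (c + 0 * W x) b)" for x
      by (intro tendsto_intros)
    then show "AE x in \<nu>. (\<lambda>k. ?u k x) \<longlonglongrightarrow> exp (l * min c b)" by simp
    show "AE x in \<nu>. norm (?u k x) \<le> exp (l * b)" for k
      using l_pos by auto
  qed auto
  have "(\<integral>\<^sup>+x. ennreal (exp (l * g x)) \<partial>\<nu>) \<le> ennreal (\<integral>x. ?u k x \<partial>\<nu>)" for k
  proof -
    have "(\<integral>\<^sup>+x. ennreal (exp (l * g x)) \<partial>\<nu>) \<le> (\<integral>\<^sup>+x. ennreal (exp (l * min (iter g k x) b)) \<partial>\<nu>)"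
      using g b by (rule nn_integral_exp_le_iter)
    also have "\<dots> \<le> (\<integral>\<^sup>+x. ennreal (?u k x) \<partial>\<nu>)"
      using l_pos min.mono[OF iter_le order_refl] by (intro nn_integral_mono ennreal_leI) simp
    also have "\<dots> = ennreal (\<integral>x. ?u k x \<partial>\<nu>)"
      using l_pos
      by (intro nn_integral_eq_integral nu.integrable_const_bound[where B = "exp (l * b)"]) auto
    finally show ?thesis .
  qed
  then have "(\<integral>\<^sup>+x. ennreal (exp (l * g x)) \<partial>\<nu>) \<le> ennreal (\<integral>x. exp (l * min c b) \<partial>\<nu>)"
    using lim by (intro LIMSEQ_le_const[OF tendsto_ennrealI[OF lim]]) auto
  also have "\<dots> \<le> ennreal (exp (l * c))"
    using l_pos by (intro ennreal_leI) auto
  also have "l * c = l * (\<integral>x. g x \<partial>\<nu>) + 4 / 3 * l\<^sup>2 * (\<integral>x. D x \<partial>\<nu>)"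
    by (simp add: c_def power2_eq_square algebra_simps)
  finally show ?thesis .
qed

text \<open>Truncating \<open>f\<close> at the height \<open>t + \<integral> f\<close> does not change the level set and only lowers the
  mean, so no exponential integrability of \<open>f\<close> is needed.\<close>

lemma measure_ge_le_exp:
  assumes f: "1-lipschitz_on UNIV f"
  shows "measure \<nu> {x. f x \<ge> t + (\<integral>y. f y \<partial>\<nu>)}
    \<le> exp (4 / 3 * l\<^sup>2 * (\<integral>x. D x \<partial>\<nu>) - l * t)"
proof -
  define b where "b = t + (\<integral>y. f y \<partial>\<nu>)"
  define g where "g x = min (f x) b" for x
  have g: "1-lipschitz_on UNIV g" unfolding g_def using f by (rule lipschitz_on_max_min)
  have [measurable]: "f \<in> borel_measurable borel" "g \<in> borel_measurable borel"
    using f g by (auto intro: lipschitz_on_borel_measurable)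
  have "(\<integral>x. g x \<partial>\<nu>) \<le> (\<integral>x. f x \<partial>\<nu>)"
    using nu.integrable_lipschitz[OF f] nu.integrable_lipschitz[OF g]
    by (intro integral_mono) (auto simp: g_def)
  then have le: "l * (\<integral>x. g x \<partial>\<nu>) \<le> l * (\<integral>x. f x \<partial>\<nu>)" using l_pos by simp
  \<comment> \<open>Markov's inequality: on the level set of \<open>f\<close> the truncation
    \<open>g\<close> equals \<open>b\<close>.\<close>
  have "ennreal (exp (l * b)) * emeasure \<nu> {x. f x \<ge> b}
      = (\<integral>\<^sup>+x. ennreal (exp (l * b)) * indicator {x. f x \<ge> b} x \<partial>\<nu>)"
    by (intro nn_integral_cmult_indicator[symmetric]) simp
  also have "\<dots> \<le> (\<integral>\<^sup>+x. ennreal (exp (l * g x)) \<partial>\<nu>)"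
    by (intro nn_integral_mono) (auto simp: g_def indicator_def min_absorb2)
  also have "\<dots> \<le> ennreal (exp (l * (\<integral>x. g x \<partial>\<nu>) + 4 / 3 * l\<^sup>2 * (\<integral>x. D x \<partial>\<nu>)))"
    using g by (rule nn_integral_exp_invariant_le[where b = b]) (simp add: g_def)
  also have "\<dots> \<le> ennreal (exp (l * (\<integral>x. f x \<partial>\<nu>) + 4 / 3 * l\<^sup>2 * (\<integral>x. D x \<partial>\<nu>)))"
    using le by (intro ennreal_leI) simp
  finally have "exp (l * b) * measure \<nu> {x. f x \<ge> b}
      \<le> exp (l * (\<integral>x. f x \<partial>\<nu>) + 4 / 3 * l\<^sup>2 * (\<integral>x. D x \<partial>\<nu>))"
    by (simp add: nu.emeasure_eq_measure ennreal_mult'[symmetric])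
  then have "measure \<nu> {x. f x \<ge> b}
      \<le> exp (l * (\<integral>x. f x \<partial>\<nu>) + 4 / 3 * l\<^sup>2 * (\<integral>x. D x \<partial>\<nu>)) / exp (l * b)"
    by (simp add: field_simps)
  also have "\<dots> = exp (4 / 3 * l\<^sup>2 * (\<integral>x. D x \<partial>\<nu>) - l * t)"
    by (simp add: exp_diff[symmetric] b_def algebra_simps)
  finally show ?thesis by (simp add: b_def)
qed

end

subsection \<open>Tail bounds\<close>

lemma exp_minus_simps [simp]: "exp_minus 0 = 1" "exp_minus \<top> = 0" "0 \<le> exp_minus a"
  by (auto simp: exp_minus_def)

lemma exp_minus_ennreal: "0 \<le> a \<Longrightarrow> exp_minus (ennreal a) = exp (- a)"
  by (simp add: exp_minus_def)

lemma numeral_mult_ennreal: "numeral k * ennreal x = ennreal (numeral k * x)"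
  by (subst ennreal_mult') simp_all

section \<open>From the hypotheses on the walk to the locales\<close>

lemma invariant_distribution_moment:
  assumes "invariant_distribution m \<nu>"
  shows "moment_prob_space \<nu>"
proof -
  have "prob_space \<nu>" "sets \<nu> = sets borel" "finite_first_moment \<nu>"
    using assms by (auto simp: invariant_distribution_def space_prob_algebra)
  then show ?thesis by (simp add: moment_prob_space_def moment_prob_space_axioms_def)
qed

lemma random_walk_moment:
  assumes "random_walk m"
  shows "moment_prob_space (m x)"
proof -
  have "m x \<in> space (prob_algebra borel)"
    using assms measurable_space[of m borel "prob_algebra borel" x] by (auto simp: random_walk_def)
  then have "prob_space (m x)" "sets (m x) = sets borel"
    by (auto simp: space_prob_algebra)
  moreover have "finite_first_moment (m x)" using assms by (simp add: random_walk_def)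
  ultimately show ?thesis by (simp add: moment_prob_space_def moment_prob_space_axioms_def)
qed

lemma measure_ge_le_exp_curvature:
  fixes m :: "'a::polish_space \<Rightarrow> 'a measure"
  assumes rw: "random_walk m" and inv: "invariant_distribution m \<nu>"
    and \<kappa>: "0 < \<kappa>" "\<kappa> \<le> 1"
    and ric: "\<And>x y. x \<noteq> y \<Longrightarrow> ricci_curvature m x y \<ge> ereal \<kappa>"
    and D: "\<And>x. D_sq_at m \<kappa> x = ennreal (D x)" "\<And>x. 0 \<le> D x"
    and lip: "C-lipschitz_on UNIV D"
    and \<sigma>: "granularity m = ennreal \<sigma>" "0 \<le> \<sigma>"
    and f: "1-lipschitz_on UNIV f"
    and l: "0 < l" "l * max (2 * C) (3 * \<sigma>) \<le> 1"
  shows "measure \<nu> {x. f x \<ge> t + (\<integral>y. f y \<partial>\<nu>)}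
    \<le> exp (4 / 3 * l\<^sup>2 * (\<integral>x. D x \<partial>\<nu>) - l * t)"
proof -
  note walk = random_walk_moment[OF rw]
  \<comment> \<open>Granularity is half a diameter, hence the jump bound
    \<open>2 * \<sigma>\<close>.\<close>
  have diam: "ennreal_diameter (support (m x)) \<le> ennreal (2 * \<sigma>)" for x
  proof -
    have "ennreal_diameter (support (m x)) / 2 \<le> ennreal \<sigma>"
      unfolding \<sigma>(1)[symmetric] granularity_def granularity_at_def by (rule SUP_upper) simp
    then have "2 * (ennreal_diameter (support (m x)) / 2) \<le> 2 * ennreal \<sigma>"
      by (rule mult_left_mono) simp
    moreover have "2 * (ennreal_diameter (support (m x)) / 2) = ennreal_diameter (support (m x))"
      by (cases "ennreal_diameter (support (m x))")
        (auto simp: ennreal_divide_numeral numeral_mult_ennreal ennreal_mult_top ennreal_top_divide)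
    ultimately show ?thesis using \<sigma>(2) by (simp add: ennreal_mult)
  qed
  have lC: "l * (2 * C) \<le> l * max (2 * C) (3 * \<sigma>)" and l\<sigma>: "l * (3 * \<sigma>) \<le> l * max (2 * C) (3 * \<sigma>)"
    using l(1) by (auto intro!: mult_left_mono)
  have "0 \<le> l * \<sigma>" using l(1) \<sigma>(2) by simp
  interpret nu: moment_prob_space \<nu> by (rule invariant_distribution_moment[OF inv])
  interpret contracting_walk \<nu> m \<kappa>
  proof (intro contracting_walk.intro contracting_walk_axioms.intro)
    show "m \<in> borel \<rightarrow>\<^sub>M subprob_algebra borel"
      using rw by (auto simp: random_walk_def intro: measurable_prob_algebraD)
    show "bind \<nu> m = \<nu>" using inv by (simp add: invariant_distribution_def)
    show "transport_dist (m x) (m y) \<le> ennreal ((1 - \<kappa>) * dist x y)" for x y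
    proof (cases "x = y")
      case True
      interpret moment_prob_space "m x" by (rule walk)
      \<comment> \<open>Curvature says nothing about equal points; the diagonal coupling has cost
        0.\<close>
      let ?\<xi> = "distr (m x) (borel \<Otimes>\<^sub>M borel) (\<lambda>z. (z, z))"
      have "?\<xi> \<in> couplings (m x) (m x)"
        by (auto simp: couplings_def distr_distr comp_def intro!: distr_id2)
      then have "transport_dist (m x) (m x) \<le> (\<integral>\<^sup>+ (x, y). ennreal (dist x y) \<partial>?\<xi>)"
        unfolding transport_dist_def by (rule INF_lower)
      also have "\<dots> = 0" by (subst nn_integral_distr) auto
      finally show ?thesis using True by simp
    qed (rule ricci_curvature_geD(1)[OF ric])
  qed (rule walk \<kappa> nu.moment_prob_space_axioms)+
  interpret variance_bounded_walk \<nu> m \<kappa> D C "2 * \<sigma>" l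
  proof
    show "ennreal_variance (m x) f \<le> ennreal (\<kappa> * D x)" if "1-lipschitz_on UNIV f" for f x
    proof -
      have "ennreal_diameter (support (m x)) < \<top>"
        using diam[of x] by (rule le_less_trans) simp
      then have "ennreal_variance (m x) f \<le> ennreal \<kappa> * D_sq_at m \<kappa> x"
        using walk \<kappa>(1) that by (intro ennreal_variance_le_D_sq_at) (auto simp: D)
      then show ?thesis using \<kappa>(1) by (simp add: D ennreal_mult')
    qed
    show "AE y in m x. AE z in m x. dist y z \<le> 2 * \<sigma>" for x
      using moment_prob_space.AE_dist_le[OF walk diam] \<sigma>(2) by simp
    show "2 * l * C \<le> 1" using lC l(2) by simp
    show "l * (2 * \<sigma>) \<le> 1" using l\<sigma> l(2) \<open>0 \<le> l * \<sigma>\<close> by simp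
  qed (rule l D lip)+
  show ?thesis using f by (rule measure_ge_le_exp)
qed

section \<open>Choice of the exponent and degenerate cases\<close>

theorem theorem32:
  fixes m :: "'a::polish_space \<Rightarrow> 'a measure"
    and \<nu> :: "'a measure"
    and \<kappa> C :: real
    and f :: "'a \<Rightarrow> real"
  assumes "random_walk m"
    and "invariant_distribution m \<nu>"
    and "ergodic m \<nu>"
    and "\<kappa> > 0"
    and "\<And>x y. x \<noteq> y \<Longrightarrow> ricci_curvature m x y \<ge> ereal \<kappa>"
    and "\<And>x. D_sq_at m \<kappa> x < \<top>"
    and "C-lipschitz_on UNIV (\<lambda>x. enn2real (D_sq_at m \<kappa> x))"
    and "1-lipschitz_on UNIV f"
  shows "(\<forall>t\<ge>0. ennreal t \<le> t_max m \<nu> \<kappa> C \<longrightarrow>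
           measure \<nu> {x. f x \<ge> t + (\<integral>y. f y \<partial>\<nu>)}
             \<le> exp_minus ((ennreal t)\<^sup>2 / (6 * D_sq m \<nu> \<kappa>))) \<and>
         (\<forall>t\<ge>0. ennreal t \<ge> t_max m \<nu> \<kappa> C \<longrightarrow>
           measure \<nu> {x. f x \<ge> t + (\<integral>y. f y \<partial>\<nu>)}
             \<le> exp_minus ((t_max m \<nu> \<kappa> C)\<^sup>2 / (6 * D_sq m \<nu> \<kappa>)
                 + (ennreal t - t_max m \<nu> \<kappa> C) / tail_scale m C))"
proof -
  interpret nu: moment_prob_space \<nu> by (rule invariant_distribution_moment[OF assms(2)])
  let ?P = "\<lambda>t. measure \<nu> {x. f x \<ge> t + (\<integral>y. f y \<partial>\<nu>)}"
  let ?T = "t_max m \<nu> \<kappa> C"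
  let ?A = "\<lambda>t. exp_minus ((ennreal t)\<^sup>2 / (6 * D_sq m \<nu> \<kappa>))"
  let ?B = "\<lambda>t. exp_minus (?T\<^sup>2 / (6 * D_sq m \<nu> \<kappa>) + (ennreal t - ?T) / tail_scale m C)"
  have "(ennreal t \<le> ?T \<longrightarrow> ?P t \<le> ?A t) \<and> (?T \<le> ennreal t \<longrightarrow> ?P t \<le> ?B t)"
    if "t \<ge> 0" for t
  proof -
    \<comment> \<open>At \<open>t = 0\<close> the claimed bounds equal 1. In the last case two
      distinct points make \<kappa> \<le> 1 available, and all scales are real.\<close>
    consider "t = 0" | "\<forall>x y :: 'a. x = y" "0 < t" | "granularity m = \<top>" "0 < t"
      | \<sigma> x y where "(x :: 'a) \<noteq> y" "granularity m = ennreal \<sigma>" "0 \<le> \<sigma>" "0 < t"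
      using \<open>t \<ge> 0\<close> by (cases "granularity m") (auto simp: less_le)
    then show ?thesis
    proof cases
      case 1
      then show ?thesis by auto
    next
      case 2
      then obtain z :: 'a where z: "\<And>y. y = z" by blast
      \<comment> \<open>In a one-point space \<open>f\<close> equals its mean, so the level set is
        empty.\<close>
      have const: "f x = f z" for x by (subst z[of x]) (rule refl)
      have "(\<integral>y. f y \<partial>\<nu>) = (\<integral>y. f z \<partial>\<nu>)"
        by (intro Bochner_Integration.integral_cong refl const)
      also have "\<dots> = f z" by simp
      finally have "\<not> f x \<ge> t + (\<integral>y. f y \<partial>\<nu>)" for x
        using const[of x] \<open>0 < t\<close> by linarith
      then show ?thesis by simp
    next
      case 3
      \<comment> \<open>Then \<open>?T = 0\<close>: the first claim is vacuous and the second bound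
        is \<open>exp_minus 0 = 1\<close>.\<close>
      then have "tail_scale m C = \<top>" by (simp add: tail_scale_def ennreal_mult_top)
      then show ?thesis using \<open>0 < t\<close> by (simp add: t_max_def)
    next
      case 4
      define D where "D x = enn2real (D_sq_at m \<kappa> x)" for x
      define d where "d = (\<integral>x. D x \<partial>\<nu>)"
      define L where "L = max (2 * C) (3 * \<sigma>)"
      have D: "D_sq_at m \<kappa> x = ennreal (D x)" "0 \<le> D x" for x
        using assms(6)[of x] by (auto simp: D_def)
      have lip: "C-lipschitz_on UNIV D" unfolding D_def by fact
      have d: "0 \<le> d" using D by (simp add: d_def)
      have D_sq: "D_sq m \<nu> \<kappa> = ennreal d"
        unfolding D_sq_def D(1) d_def using D(2) lip
        by (intro nn_integral_eq_integral nu.integrable_lipschitz) auto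
      have C: "0 \<le> C" using lip by (rule lipschitz_on_nonneg)
      have L: "0 \<le> L" using C by (simp add: L_def)
      have tail: "tail_scale m C = ennreal L"
        using C 4 by (simp add: tail_scale_def L_def numeral_mult_ennreal max_def)
      have "\<kappa> \<le> 1" using assms(5)[OF 4(1)] 4(1) by (rule ricci_curvature_geD)
      have key: "?P t \<le> exp (4 / 3 * l\<^sup>2 * d - l * t)" if "0 < l" "l * L \<le> 1" for l
        using that unfolding d_def L_def
        by (intro measure_ge_le_exp_curvature[OF assms(1,2,4) \<open>\<kappa> \<le> 1\<close> assms(5) D lip 4(2,3) assms(8)])
      have A: "?P t \<le> ?A t" if "0 < d" "t * L \<le> 2 * d"
      proof -
        \<comment> \<open>The exponent becomes
          \<open>t\<^sup>2 / (3 * d) - t\<^sup>2 / (2 * d)\<close>, and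
          \<open>?l * L \<le> 1\<close> amounts to \<open>t * L \<le> 2 * d\<close>.\<close>
        let ?l = "t / (2 * d)"
        have "?P t \<le> exp (4 / 3 * ?l\<^sup>2 * d - ?l * t)"
          using that 4 by (intro key) (auto simp: field_simps)
        also have "4 / 3 * ?l\<^sup>2 * d - ?l * t = - (t\<^sup>2 / (6 * d))"
          using that by (simp add: power2_eq_square field_simps)
        also have "exp \<dots> = ?A t"
          using that 4 by (simp add: D_sq exp_minus_ennreal[symmetric] ennreal_power divide_ennreal
              numeral_mult_ennreal)
        finally show ?thesis .
      qed
      consider "L = 0" "d = 0" | "L = 0" "0 < d" | "0 < L"
        using L d by linarith
      then show ?thesis
      proof cases
        case 1
        \<comment> \<open>With \<open>L = 0\<close> every positive \<open>l\<close> is admissible,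
          so \<open>l = n\<close> may grow and the level set has measure 0.\<close>
        have "(\<lambda>n. exp (- (real n * t))) \<longlonglongrightarrow> 0"
        proof -
          have "(\<lambda>n. exp (- t) ^ n) \<longlonglongrightarrow> 0"
            using \<open>0 < t\<close> by (intro LIMSEQ_power_zero) auto
          then show ?thesis by (simp only: exp_of_nat_mult[symmetric] mult_minus_right)
        qed
        moreover have "?P t \<le> exp (- (real n * t))" if "n \<ge> 1" for n
          using key[of "real n"] that 1 by simp
        ultimately have "?P t \<le> 0" by (intro LIMSEQ_le_const) auto
        also have "0 \<le> ?B t" by simp
        finally have "?P t \<le> ?B t" .
        moreover have "?T = 0" by (simp add: t_max_def D_sq 1)
        then have "\<not> ennreal t \<le> ?T" using \<open>0 < t\<close> by (simp add: not_le)
        ultimately show ?thesis by blast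
      next
        case 2
        \<comment> \<open>The second claim is vacuous, and \<open>t * L = 0\<close> makes the
          Gaussian bound available for every \<open>t\<close>.\<close>
        then have "?T = \<top>" by (simp add: t_max_def D_sq tail)
        then show ?thesis using A 2 by (auto simp: top_unique)
      next
        case 3
        then have T: "?T = ennreal (2 * d / L)"
          using d by (simp add: t_max_def D_sq tail divide_ennreal numeral_mult_ennreal)
        have "?P t \<le> ?A t" if "ennreal t \<le> ?T"
        proof -
          have "t \<le> 2 * d / L" using that d 3 by (simp add: T)
          then have "t * L \<le> 2 * d" using 3 by (simp add: pos_le_divide_eq)
          \<comment> \<open>Together with the previous bound this yields \<open>0 < d\<close>, which
            \<open>A\<close> requires.\<close>
          moreover have "0 < t * L" using 3 \<open>0 < t\<close> by simp
          ultimately show ?thesis by (intro A) auto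
        qed
        moreover have "?P t \<le> ?B t" if "?T \<le> ennreal t"
        proof -
          have t: "2 * d / L \<le> t" using that \<open>0 < t\<close> by (simp add: T)
          have sq: "?T\<^sup>2 / (6 * D_sq m \<nu> \<kappa>) = ennreal (2 * d / (3 * L\<^sup>2))"
          \<comment> \<open>For \<open>d = 0\<close> the quotient is \<open>0 / 0 = 0\<close> in
            \<open>ennreal\<close>, in agreement with the right-hand side.\<close>
          proof (cases "d = 0")
            case False
            have "?T\<^sup>2 / (6 * D_sq m \<nu> \<kappa>) = ennreal ((2 * d / L)\<^sup>2 / (6 * d))"
              using d 3 False by (simp add: T D_sq ennreal_power divide_ennreal
                  numeral_mult_ennreal)
            also have "(2 * d / L)\<^sup>2 / (6 * d) = 2 * d / (3 * L\<^sup>2)"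
              using 3 False by (simp add: power2_eq_square field_simps)
            finally show ?thesis .
          qed (simp add: T)
          have lin: "(ennreal t - ?T) / tail_scale m C = ennreal ((t - 2 * d / L) / L)"
            using d 3 t by (simp add: T tail ennreal_minus divide_ennreal)
          \<comment> \<open>\<open>1 / L\<close> is the largest admissible \<open>l\<close>; its
            exponent is affine in \<open>t\<close> and meets the Gaussian one at
            \<open>t = 2 * d / L\<close>.\<close>
          have "?P t \<le> exp (4 / 3 * (1 / L)\<^sup>2 * d - 1 / L * t)"
            using 3 by (intro key) auto
          also have "4 / 3 * (1 / L)\<^sup>2 * d - 1 / L * t
              = - (2 * d / (3 * L\<^sup>2) + (t - 2 * d / L) / L)"
            using 3 by (simp add: power2_eq_square field_simps)
          also have "exp \<dots> = ?B t"
            using d 3 t by (simp add: sq lin exp_minus_ennreal flip: ennreal_plus)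
          finally show ?thesis .
        qed
        ultimately show ?thesis by blast
      qed
    qed
  qed
  then show ?thesis by blast
qed

end
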